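(* Let $\Sigma$ be a finite alphabet and $L\subset\Sigma^{\ast}$ a regular language. If some automaton over $\Sigma$ with the interval language $L$ has the trace language $L_{\circ}$, then for every language $L'\subset\Sigma^{\ast}$ that is the trace language of some automaton over $\Sigma$, the language $$L_{\circ}+L'$$ is the trace language of an automaton with the interval language $L$.
   Context: An automaton $(Q)=(Q,\delta,Q_{\mathsf{in}},Q_{\mathsf{t}})$ over $\Sigma$ is a nondeterministic finite automaton: a finite set $Q$ of states, transition function $\delta:Q\times\Sigma\to\mathscr{P}(Q)$, and arbitrary (possibly empty) subsets $Q_{\mathsf{in}},Q_{\mathsf{t}}\subset Q$ of initial and accepting states. Its graph has vertex set $Q$ and an oriented edge labelled $a$ from $q$ to $q'$ for each $a\in\Sigma$, $q'\in\delta(q,a)$. The interval language $L_{\mathsf{I},(Q)}$ is the language accepted by $(Q)$: words $\omega$ read along some oriented path from an initial to an accepting state. The trace language $L_{\circ,(Q)}$ consists of words $\omega$ such that for some state $q$ there is an oriented path reading $\omega$ that starts and ends at $q$ (length-zero paths, reading the empty word, are allowed). The sum $L_1+L_2$ of languages is their union $L_1\cup L_2$. *)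

theory Defs
  imports Main
begin

record ('q, 'a) automaton =
  states :: "'q set"
  transition :: "'q \<Rightarrow> 'a \<Rightarrow> 'q set"
  initial :: "'q set"
  accepting :: "'q set"

(* The transition function is only meaningful on states A and Sigma; its values elsewhere are
   unconstrained, and paths never use them. *)
definition is_automaton :: "'a set \<Rightarrow> ('q, 'a) automaton \<Rightarrow> bool" where
  "is_automaton \<Sigma> A \<longleftrightarrow>
     finite (states A) \<and>
     (\<forall>q\<in>states A. \<forall>a\<in>\<Sigma>. transition A q a \<subseteq> states A) \<and>
     initial A \<subseteq> states A \<and> accepting A \<subseteq> states A"

inductive reads :: "'a set \<Rightarrow> ('q, 'a) automaton \<Rightarrow> 'q \<Rightarrow> 'a list \<Rightarrow> 'q \<Rightarrow> bool"
  for \<Sigma> :: "'a set" and A :: "('q, 'a) automaton" where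
  Nil: "q \<in> states A \<Longrightarrow> reads \<Sigma> A q [] q"
| Cons: "\<lbrakk>q \<in> states A; a \<in> \<Sigma>; q' \<in> transition A q a; reads \<Sigma> A q' w r\<rbrakk>
    \<Longrightarrow> reads \<Sigma> A q (a # w) r"

definition interval_language :: "'a set \<Rightarrow> ('q, 'a) automaton \<Rightarrow> 'a list set" where
  "interval_language \<Sigma> A =
     {w. \<exists>q\<in>initial A. \<exists>r\<in>accepting A. reads \<Sigma> A q w r}"

definition trace_language :: "'a set \<Rightarrow> ('q, 'a) automaton \<Rightarrow> 'a list set" where
  "trace_language \<Sigma> A = {w. \<exists>q\<in>states A. reads \<Sigma> A q w q}"

(* A type of states cannot be quantified existentially; natural numbers lose no generality,
   since every automaton with finitely many states is isomorphic to one with states in nat. *)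
definition regular_language :: "'a set \<Rightarrow> 'a list set \<Rightarrow> bool" where
  "regular_language \<Sigma> L \<longleftrightarrow>
     (\<exists>A :: (nat, 'a) automaton. is_automaton \<Sigma> A \<and> interval_language \<Sigma> A = L)"

end

theory Submission imports Defs begin

text \<open>
  Place next to the automaton with interval language \<open>L\<close> a disjoint copy of the automaton
  with trace language \<open>L'\<close>, in which no state is initial or accepting. No edge joins the two
  parts, so each path stays in the part where it starts. Every accepting path starts in the first
  part, hence the interval language is still \<open>L\<close>; a closed path lies in the first part or in
  the second, hence the trace language is the union of the two trace languages.

  Both parts are handled by one fact, \<open>reads_of_embedding\<close>: an injective copy of an automaton
  that no edge leaves has exactly the paths of the original.
\<close>

text \<open>
  The equation for the transitions carries both directions: every edge is copied, and
  no other edge starts at a copied state. Injectivity lets \<open>embeds\<close> transport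
  closed paths and membership in sets of states back to the original.
\<close>

definition embeds :: "'a set \<Rightarrow> ('q \<Rightarrow> 's) \<Rightarrow> ('q, 'a) automaton \<Rightarrow> ('s, 'a) automaton \<Rightarrow> bool" where
  "embeds \<Sigma> f A C \<longleftrightarrow> inj_on f (states A) \<and> f ` states A \<subseteq> states C \<and>
     (\<forall>q\<in>states A. \<forall>a\<in>\<Sigma>. transition C (f q) a = f ` transition A q a)"

lemma reads_states:
  assumes "reads \<Sigma> A q w r"
  shows "q \<in> states A" "r \<in> states A"
  using assms by (induction) auto

lemma reads_image:
  assumes "embeds \<Sigma> f A C" "reads \<Sigma> A q w r"
  shows "reads \<Sigma> C (f q) w (f r)"
  using assms(2)
proof induction
  case (Nil q)
  with assms(1) show ?case by (auto simp: embeds_def intro: reads.Nil)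
next
  case (Cons q a q' w r)
  with assms(1) have "f q \<in> states C" "f q' \<in> transition C (f q) a"
    by (auto simp: embeds_def)
  with Cons show ?case by (blast intro: reads.Cons)
qed

lemma reads_from_image:
  assumes "is_automaton \<Sigma> A" "embeds \<Sigma> f A C" "reads \<Sigma> C (f q) w s" "q \<in> states A"
  shows "\<exists>r. s = f r \<and> reads \<Sigma> A q w r"
  using assms(3,4)
proof (induction "f q" w s arbitrary: q)
  case Nil
  then show ?case by (blast intro: reads.Nil)
next
  case (Cons a p w s)
  from Cons.hyps Cons.prems assms(2) obtain q' where q': "q' \<in> transition A q a" "p = f q'"
    by (auto simp: embeds_def)
  with assms(1) Cons.hyps Cons.prems have "q' \<in> states A"
    unfolding is_automaton_def by blast
  with Cons.hyps(5) q'(2) obtain r where "s = f r" "reads \<Sigma> A q' w r" by blast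
  with q'(1) Cons.hyps Cons.prems show ?case by (blast intro: reads.Cons)
qed

lemma reads_of_embedding:
  assumes "is_automaton \<Sigma> A" "embeds \<Sigma> f A C" "q \<in> states A" "r \<in> states A"
  shows "reads \<Sigma> C (f q) w (f r) \<longleftrightarrow> reads \<Sigma> A q w r"
proof
  assume "reads \<Sigma> C (f q) w (f r)"
  with assms obtain r' where r': "f r = f r'" "reads \<Sigma> A q w r'"
    by (blast dest: reads_from_image)
  moreover have "r = r'"
    using assms(2,4) r' reads_states(2)[OF r'(2)] by (auto simp: embeds_def dest: inj_onD)
  ultimately show "reads \<Sigma> A q w r" by simp
qed (rule reads_image[OF assms(2)])

lemma interval_language_of_embedding:
  assumes "is_automaton \<Sigma> A" "embeds \<Sigma> f A C"
    and "initial C = f ` initial A" "accepting C = f ` accepting A"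
  shows "interval_language \<Sigma> C = interval_language \<Sigma> A"
proof -
  have "initial A \<subseteq> states A" "accepting A \<subseteq> states A"
    using assms(1) by (auto simp: is_automaton_def)
  then show ?thesis
    unfolding interval_language_def assms(3,4) bex_simps
    using reads_of_embedding[OF assms(1,2)] by blast
qed

lemma trace_language_of_cover:
  assumes "is_automaton \<Sigma> A" "embeds \<Sigma> f A C" "is_automaton \<Sigma> B" "embeds \<Sigma> g B C"
    and "states C = f ` states A \<union> g ` states B"
  shows "trace_language \<Sigma> C = trace_language \<Sigma> A \<union> trace_language \<Sigma> B"
  unfolding trace_language_def assms(5) bex_Un bex_simps
  using reads_of_embedding[OF assms(1,2)] reads_of_embedding[OF assms(3,4)] by blast

text \<open>
  The injection \<open>h\<close> names the states of the disjoint union by elements of a type given in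
  advance, such as the natural numbers.
\<close>

definition juxtaposition ::
    "('q + 'r \<Rightarrow> 's) \<Rightarrow> ('q, 'a) automaton \<Rightarrow> ('r, 'a) automaton \<Rightarrow> ('s, 'a) automaton" where
  "juxtaposition h A B =
     \<lparr>states = h ` (states A <+> states B),
      transition = (\<lambda>s a. h ` ((\<Union>q\<in>{q\<in>states A. h (Inl q) = s}. transition A q a) <+>
                              (\<Union>q\<in>{q\<in>states B. h (Inr q) = s}. transition B q a))),
      initial = (h \<circ> Inl) ` initial A,
      accepting = (h \<circ> Inl) ` accepting A\<rparr>"

lemma is_automaton_juxtaposition:
  assumes "is_automaton \<Sigma> A" "is_automaton \<Sigma> B"
  shows "is_automaton \<Sigma> (juxtaposition h A B)"
proof -
  have "finite (states (juxtaposition h A B))"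
    using assms by (simp add: is_automaton_def juxtaposition_def)
  moreover have "transition (juxtaposition h A B) s a \<subseteq> states (juxtaposition h A B)"
    if "a \<in> \<Sigma>" for s a
    unfolding juxtaposition_def automaton.simps
    using assms that unfolding is_automaton_def by (intro image_mono) blast
  moreover have "initial A \<subseteq> states A" "accepting A \<subseteq> states A"
    using assms(1) by (auto simp: is_automaton_def)
  ultimately show ?thesis
    unfolding is_automaton_def by (auto simp: juxtaposition_def)
qed

lemma embeds_juxtaposition:
  assumes "inj_on h (states A <+> states B)"
  shows "embeds \<Sigma> (h \<circ> Inl) A (juxtaposition h A B)"
    and "embeds \<Sigma> (h \<circ> Inr) B (juxtaposition h A B)"
proof -
  have eq: "h x = h y \<longleftrightarrow> x = y" if "x \<in> states A <+> states B" "y \<in> states A <+> states B" for x y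
    using assms that by (auto dest: inj_onD)
  (* Injectivity makes each of the two unions over preimages collapse to one set or to none. *)
  have "{q'\<in>states A. h (Inl q') = h (Inl q)} = {q}"
    and "{q'\<in>states B. h (Inr q') = h (Inl q)} = {}" if "q \<in> states A" for q
    using that by (auto simp: eq InlI InrI)
  then show "embeds \<Sigma> (h \<circ> Inl) A (juxtaposition h A B)"
    by (auto simp: embeds_def juxtaposition_def inj_on_def eq InlI image_image)
  have "{q'\<in>states A. h (Inl q') = h (Inr q)} = {}"
    and "{q'\<in>states B. h (Inr q') = h (Inr q)} = {q}" if "q \<in> states B" for q
    using that by (auto simp: eq InlI InrI)
  then show "embeds \<Sigma> (h \<circ> Inr) B (juxtaposition h A B)"
    by (auto simp: embeds_def juxtaposition_def inj_on_def eq InrI image_image)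
qed

theorem proposition3p4:
  fixes \<Sigma> :: "'a set" and L L\<^sub>o :: "'a list set"
  assumes "finite \<Sigma>"
    and "L \<subseteq> lists \<Sigma>" and "regular_language \<Sigma> L"
    and "\<exists>A :: ('q, 'a) automaton. is_automaton \<Sigma> A \<and>
           interval_language \<Sigma> A = L \<and> trace_language \<Sigma> A = L\<^sub>o"
  shows "\<forall>L'. L' \<subseteq> lists \<Sigma> \<longrightarrow>
           (\<exists>B :: ('r, 'a) automaton. is_automaton \<Sigma> B \<and> trace_language \<Sigma> B = L') \<longrightarrow>
           (\<exists>C :: (nat, 'a) automaton. is_automaton \<Sigma> C \<and>
              interval_language \<Sigma> C = L \<and> trace_language \<Sigma> C = L\<^sub>o \<union> L')"
proof (intro allI impI)
  fix L' assume "\<exists>B :: ('r, 'a) automaton. is_automaton \<Sigma> B \<and> trace_language \<Sigma> B = L'"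
  then obtain B :: "('r, 'a) automaton" where B: "is_automaton \<Sigma> B" "trace_language \<Sigma> B = L'"
    by blast
  from assms(4) obtain A :: "('q, 'a) automaton" where A: "is_automaton \<Sigma> A"
      "interval_language \<Sigma> A = L" "trace_language \<Sigma> A = L\<^sub>o"
    by blast
  have "finite (states A <+> states B)"
    using A(1) B(1) by (simp add: is_automaton_def)
  then obtain h :: "'q + 'r \<Rightarrow> nat" where h: "inj_on h (states A <+> states B)"
    by (blast dest: finite_imp_inj_to_nat_seg)
  let ?C = "juxtaposition h A B"
  note emb = embeds_juxtaposition[OF h, of \<Sigma>]
  have "interval_language \<Sigma> ?C = L"
    using interval_language_of_embedding[OF A(1) emb(1)] A(2) by (simp add: juxtaposition_def)
  moreover have "states ?C = (h \<circ> Inl) ` states A \<union> (h \<circ> Inr) ` states B"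
    by (auto simp: juxtaposition_def)
  then have "trace_language \<Sigma> ?C = L\<^sub>o \<union> L'"
    using trace_language_of_cover[OF A(1) emb(1) B(1) emb(2)] A(3) B(2) by simp
  ultimately show "\<exists>C :: (nat, 'a) automaton. is_automaton \<Sigma> C \<and>
      interval_language \<Sigma> C = L \<and> trace_language \<Sigma> C = L\<^sub>o \<union> L'"
    using is_automaton_juxtaposition[OF A(1) B(1)] by blast
qed

end
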